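(* The $\mathbb{K}$-linear span $\mathbf{FSym}$ of the elements $\mathbf{S}_t$, $t$ running over standard Young tableaux of all sizes $n\ge1$, is stable under the $\#$ product: for any standard tableaux $t',t''$, $\mathbf{S}_{t'}\#\mathbf{S}_{t''}$ is a linear combination of elements $\mathbf{S}_t$.
   Context: Let $A=\{a_1<a_2<\cdots\}$ be an infinite totally ordered alphabet and $\mathbb{K}$ a field; work with formal $\mathbb{K}$-linear combinations of nonempty words over $A$. The $\#$ product of words is $(ux)\#(yv)=uxv$ if the letters $x,y$ are equal and $0$ otherwise ($u,v$ words, $x,y$ letters), extended bilinearly. $\mathrm{std}(w)$ is the standardization of a word (number left to right the occurrences of the smallest letter $1,2,\dots$, then those of the next letter, etc.), $\mathbf{G}_\sigma=\sum_{\mathrm{std}(w)=\sigma}w$ and $\mathbf{F}_\sigma=\mathbf{G}_{\sigma^{-1}}$. For a permutation $\sigma$, $P(\sigma)$ denotes its insertion tableau (P-symbol) under the Robinson–Schensted correspondence. For a standard tableau $t$, $\mathbf{S}_t=\sum_{P(\sigma)=t}\mathbf{F}_\sigma$. *)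

theory Defs
  imports Complex_Main "HOL-Library.Function_Algebras" "HOL-Combinatorics.Permutations"
begin

(* A formal, possibly infinite, linear combination of words is the function giving the
   coefficient of each word; addition is the pointwise one of Function_Algebras.
   Combinations of nonempty words are those with coefficient 0 at []. *)
type_synonym ('a, 'k) series = "'a list \<Rightarrow> 'k"

definition series_scale :: "'k::field \<Rightarrow> ('a, 'k) series \<Rightarrow> ('a, 'k) series" where
  "series_scale c f = (\<lambda>w. c * f w)"

lemma vector_space_series: "vector_space (series_scale :: 'k::field \<Rightarrow> ('a, 'k) series \<Rightarrow> _)"
  by unfold_locales (auto simp: series_scale_def algebra_simps fun_eq_iff)

(* (ux)#(yv), with None standing for the value 0. *)
definition sharp_words :: "'a list \<Rightarrow> 'a list \<Rightarrow> 'a list option" where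
  "sharp_words p q =
     (if p \<noteq> [] \<and> q \<noteq> [] \<and> last p = hd q then Some (butlast p @ [last p] @ tl q) else None)"

lemma sharp_words_snoc_Cons:
  "sharp_words (u @ [x]) (y # v) = (if x = y then Some (u @ [x] @ v) else None)"
  by (simp add: sharp_words_def)

(* Each word has finitely many preimages, so the bilinear extension makes sense for
   infinite combinations too, and the sums below are sums over finite sets. *)
lemma finite_sharp_words: "finite {(p, q). sharp_words p q = Some w}"
proof -
  have "{(p, q). sharp_words p q = Some w} \<subseteq> (\<lambda>i. (take (Suc i) w, drop i w)) ` {..<length w}"
  proof clarify
    fix p q assume h: "sharp_words p q = Some w"
    then have "p \<noteq> []" "q \<noteq> []" by (auto simp: sharp_words_def split: if_splits)
    then obtain u x y v where p: "p = u @ [x]" and q: "q = y # v"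
      by (metis neq_Nil_conv rev_exhaust)
    with h have w: "w = u @ [x] @ v" and "x = y"
      by (auto simp: sharp_words_snoc_Cons split: if_splits)
    then have "p = take (Suc (length u)) w" "q = drop (length u) w" "length u < length w"
      by (simp_all add: p q)
    then show "(p, q) \<in> (\<lambda>i. (take (Suc i) w, drop i w)) ` {..<length w}" by blast
  qed
  then show ?thesis by (rule finite_subset) simp
qed

definition sharp :: "('a, 'k::field) series \<Rightarrow> ('a, 'k) series \<Rightarrow> ('a, 'k) series"
    (infixl "\<sharp>" 70) where
  "f \<sharp> g = (\<lambda>w. \<Sum>(p, q) \<in> {(p, q). sharp_words p q = Some w}. f p * g q)"

(* The number given to position i: the positions numbered up to and including i are those
   carrying a smaller letter, and those not to the right of i carrying the same letter. *)
definition standardization :: "'a::linorder list \<Rightarrow> nat list" where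
  "standardization w =
     map (\<lambda>i. card {j. j < length w \<and> (w ! j < w ! i \<or> w ! j = w ! i \<and> j \<le> i)}) [0..<length w]"

(* A permutation of {1..n} is a function permuting {1..n}. As the function does not determine n,
   n is an explicit parameter throughout. *)
definition perm_word :: "nat \<Rightarrow> (nat \<Rightarrow> nat) \<Rightarrow> nat list" where
  "perm_word n \<sigma> = map \<sigma> [1..<Suc n]"

definition G :: "nat \<Rightarrow> (nat \<Rightarrow> nat) \<Rightarrow> ('a::linorder, 'k::field) series" where
  "G n \<sigma> = (\<lambda>w. if standardization w = perm_word n \<sigma> then 1 else 0)"

definition F :: "nat \<Rightarrow> (nat \<Rightarrow> nat) \<Rightarrow> ('a::linorder, 'k::field) series" where
  "F n \<sigma> = G n (inv \<sigma>)"

(* Tableaux are lists of rows, the longest row first. *)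
definition standard_tableau :: "nat list list \<Rightarrow> bool" where
  "standard_tableau t \<longleftrightarrow>
     [] \<notin> set t \<and> sorted_wrt (\<ge>) (map length t) \<and>
     distinct (concat t) \<and> set (concat t) = {1..length (concat t)} \<and>
     (\<forall>r \<in> set t. sorted_wrt (<) r) \<and>
     (\<forall>i j. Suc i < length t \<and> j < length (t ! Suc i) \<longrightarrow> t ! i ! j < t ! Suc i ! j)"

(* Schensted row insertion; the second component is the bumped entry, if any. *)
fun row_insert :: "'a::linorder \<Rightarrow> 'a list \<Rightarrow> 'a list \<times> 'a option" where
  "row_insert x [] = ([x], None)"
| "row_insert x (y # ys) =
     (if x < y then (x # ys, Some y) else (let (zs, b) = row_insert x ys in (y # zs, b)))"

fun tableau_insert :: "'a::linorder \<Rightarrow> 'a list list \<Rightarrow> 'a list list" where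
  "tableau_insert x [] = [[x]]"
| "tableau_insert x (r # rs) =
     (case row_insert x r of
        (r', None) \<Rightarrow> r' # rs
      | (r', Some y) \<Rightarrow> r' # tableau_insert y rs)"

definition P_symbol :: "'a::linorder list \<Rightarrow> 'a list list" where
  "P_symbol w = fold tableau_insert w []"

definition S :: "nat list list \<Rightarrow> ('a::linorder, 'k::field) series" where
  "S t = (let n = length (concat t) in
     \<Sum>\<sigma> \<in> {\<sigma>. \<sigma> permutes {1..n} \<and> P_symbol (perm_word n \<sigma>) = t}. F n \<sigma>)"

(* The empty list is the tableau of size 0. *)
definition FSym :: "('a::linorder, 'k::field) series set" where
  "FSym = module.span series_scale {S t |t. standard_tableau t \<and> t \<noteq> []}"

end

theory Submission imports Defs "HOL-Library.Multiset" begin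

text \<open>The coefficient of a word \<open>w\<close> in \<open>S t\<close> is 1 if the recording tableau
  \<open>Q(w) = P(std(w)\<^sup>-\<^sup>1)\<close> is \<open>t\<close>, and 0 otherwise. Hence the coefficient of \<open>w\<close> in
  \<open>S t' \<sharp> S t''\<close> is 1 if the prefix and the suffix of \<open>w\<close> of the relevant lengths,
  overlapping in one letter, have recording tableaux \<open>t'\<close> and \<open>t''\<close>, and 0 otherwise. Passing
  to a factor of \<open>w\<close> restricts \<open>std(w)\<^sup>-\<^sup>1\<close> to an interval of values. Words have the same
  insertion tableau iff they are Knuth equivalent, and Knuth equivalence is stable under restriction
  to an interval. So the coefficient depends on \<open>Q(w)\<close> only, and \<open>S t' \<sharp> S t''\<close> is the
  sum of the \<open>S t\<close> over finitely many \<open>t\<close>.\<close>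

section \<open>Knuth equivalence\<close>

text \<open>The plactic relations; strict and weak inequalities are placed to match a row insertion
  that bumps the first strictly larger entry.\<close>

inductive knuth_step :: "'a::linorder list \<Rightarrow> 'a list \<Rightarrow> bool" where
  "x < y \<Longrightarrow> y \<le> z \<Longrightarrow> knuth_step [y, x, z] [y, z, x]"
| "x \<le> y \<Longrightarrow> y < z \<Longrightarrow> knuth_step [x, z, y] [z, x, y]"

inductive knuth :: "'a::linorder list \<Rightarrow> 'a list \<Rightarrow> bool" where
  knuth_refl: "knuth u u"
| knuth_sym: "knuth u v \<Longrightarrow> knuth v u"
| knuth_trans [trans]: "knuth u v \<Longrightarrow> knuth v w \<Longrightarrow> knuth u w"
| knuth_of_step: "knuth_step u v \<Longrightarrow> knuth (p @ u @ q) (p @ v @ q)"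

lemma knuth_append_both: "knuth u v \<Longrightarrow> knuth (p @ u @ q) (p @ v @ q)"
proof (induction rule: knuth.induct)
  case (knuth_of_step u v p' q')
  then show ?case
    using knuth.knuth_of_step[of u v "p @ p'" "q' @ q"] by simp
qed (blast intro: knuth_refl knuth_sym knuth_trans)+

lemma knuth_append_left: "knuth u v \<Longrightarrow> knuth (p @ u) (p @ v)"
  using knuth_append_both[of u v p "[]"] by simp

lemma knuth_append_right: "knuth u v \<Longrightarrow> knuth (u @ q) (v @ q)"
  using knuth_append_both[of u v "[]" q] by simp

text \<open>Both relations exchange the smallest and the largest letter. If \<open>Q\<close> keeps
  both, convexity keeps the middle one and the step survives; otherwise the two filtered words
  coincide.\<close>

lemma knuth_step_filter:
  assumes "knuth_step u v"
    and convex: "\<And>x y z. Q x \<Longrightarrow> Q z \<Longrightarrow> x \<le> y \<Longrightarrow> y \<le> z \<Longrightarrow> Q y"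
  shows "filter Q u = filter Q v \<or> knuth_step (filter Q u) (filter Q v)"
  using assms(1)
proof cases
  case (1 x y z)
  then show ?thesis using convex[of x z y] by (auto intro: knuth_step.intros)
next
  case (2 x y z)
  then show ?thesis using convex[of x z y] by (auto intro: knuth_step.intros)
qed

lemma knuth_filter:
  assumes "knuth u v"
    and convex: "\<And>x y z. Q x \<Longrightarrow> Q z \<Longrightarrow> x \<le> y \<Longrightarrow> y \<le> z \<Longrightarrow> Q y"
  shows "knuth (filter Q u) (filter Q v)"
  using assms(1)
proof (induction rule: knuth.induct)
  case (knuth_of_step u v p q)
  have "filter Q u = filter Q v \<or> knuth_step (filter Q u) (filter Q v)"
    using knuth_of_step convex by (rule knuth_step_filter)
  then show ?case
    by (auto intro: knuth_refl knuth.knuth_of_step)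
qed (blast intro: knuth_refl knuth_sym knuth_trans)+

lemma knuth_set: "knuth u v \<Longrightarrow> set u = set v"
  by (induction rule: knuth.induct) (auto elim: knuth_step.cases)

text \<open>Monotonicity is asked only on the occurring letters, because the map applied later is
  truncated subtraction of \<open>m\<close>, which is strictly increasing only from \<open>m\<close>
  on.\<close>

lemma knuth_map:
  assumes "knuth u v" "strict_mono_on (set u) f"
  shows "knuth (map f u) (map f v)"
  using assms
proof (induction rule: knuth.induct)
  case (knuth_of_step u v p q)
  have "knuth_step (map f u) (map f v)"
    using knuth_of_step.hyps
  proof cases
    case (1 x y z)
    have "f x < f y" "f y \<le> f z"
      using knuth_of_step.prems 1 by (auto simp: strict_mono_on_def le_less)
    then show ?thesis using 1 by (auto intro: knuth_step.intros)
  next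
    case (2 x y z)
    have "f x \<le> f y" "f y < f z"
      using knuth_of_step.prems 2 by (auto simp: strict_mono_on_def le_less)
    then show ?thesis using 2 by (auto intro: knuth_step.intros)
  qed
  then show ?case by (auto intro: knuth.knuth_of_step)
next
  case (knuth_sym u v)
  then show ?case using knuth_set by (metis knuth.knuth_sym)
next
  case (knuth_trans u v w)
  then show ?case using knuth_set by (metis knuth.knuth_trans)
qed (rule knuth_refl)

section \<open>Row insertion\<close>

lemma row_insert_mset:
  "row_insert x r = (r', b) \<Longrightarrow> add_mset x (mset r) = mset r' + mset (case b of None \<Rightarrow> [] | Some y \<Rightarrow> [y])"
  by (induction r arbitrary: r') (auto split: if_splits prod.splits option.splits)

lemma row_insert_set:
  assumes "row_insert x r = (r', b)"
  shows "insert x (set r) = set r' \<union> set_option b"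
proof -
  have "set_mset (add_mset x (mset r)) = set r' \<union> set_option b"
    using row_insert_mset[OF assms] by (auto split: option.splits)
  then show ?thesis by simp
qed

lemma row_insert_sorted:
  assumes "row_insert x r = (r', b)" "sorted r"
  shows "sorted r'"
  using assms
proof (induction r arbitrary: r')
  case (Cons h rs)
  show ?case
  proof (cases "x < h")
    case True
    then have "x \<le> k" if "k \<in> set rs" for k
      using Cons.prems(2) that by force
    then show ?thesis using True Cons.prems by auto
  next
    case False
    then obtain rs' where rs': "row_insert x rs = (rs', b)" "r' = h # rs'"
      using Cons.prems by (auto split: prod.splits)
    have "set rs' \<subseteq> insert x (set rs)"
      using row_insert_set[OF rs'(1)] by auto
    then show ?thesis
      using Cons.IH[OF rs'(1)] Cons.prems(2) rs'(2) False by auto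
  qed
qed auto

lemma row_insert_bumped:
  "row_insert x r = (r', Some y) \<Longrightarrow> x < y \<and> y \<in> set r"
  by (induction r arbitrary: r') (auto split: if_splits prod.splits)

lemma row_insert_None: "row_insert x r = (r', None) \<Longrightarrow> r' = r @ [x]"
  by (induction r arbitrary: r') (auto split: if_splits prod.splits)

lemma row_insert_hd_le:
  assumes "row_insert x r = (r', b)"
  shows "\<exists>f fs. r' = f # fs \<and> f \<le> x"
  using assms by (cases r) (auto split: if_splits prod.splits)

text \<open>Being smaller than the whole row, \<open>x\<close> passes an entry by the first
  relation, in which the left neighbour of that entry serves as \<open>y\<close>. As
  \<open>h\<close> has no left neighbour, \<open>x\<close> stops right behind it.\<close>

lemma knuth_move_left:
  assumes "sorted (h # rs)" "x < h"
  shows "knuth (h # rs @ [x]) (h # x # rs)"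
  using assms
proof (induction rs arbitrary: h)
  case (Cons k ks)
  have "knuth ([h] @ (k # ks @ [x])) ([h] @ (k # x # ks))"
    by (intro knuth_append_left Cons.IH) (use Cons.prems in auto)
  also have "knuth ([] @ [h, k, x] @ ks) ([] @ [h, x, k] @ ks)"
    by (intro knuth_sym[OF knuth_of_step] knuth_step.intros) (use Cons.prems in auto)
  then have "knuth ([h] @ (k # x # ks)) (h # x # k # ks)" by simp
  finally show ?case by simp
qed (auto intro: knuth_refl)

text \<open>If \<open>x\<close> does not bump the head \<open>h\<close>, the entry \<open>y\<close>
  bumped from the tail still has to cross \<open>h\<close>. The first entry \<open>f\<close> of the
  new tail satisfies \<open>h \<le> f < y\<close> and permits this by the second relation.\<close>

lemma knuth_row_insert:
  assumes "row_insert x r = (r', Some y)" "sorted r"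
  shows "knuth (r @ [x]) (y # r')"
  using assms
proof (induction r arbitrary: r')
  case (Cons h rs)
  show ?case
  proof (cases "x < h")
    case True
    then show ?thesis using Cons.prems knuth_move_left by auto
  next
    case False
    then obtain rs' where rs': "row_insert x rs = (rs', Some y)" "r' = h # rs'"
      using Cons.prems by (auto split: prod.splits)
    obtain f fs where f: "rs' = f # fs" "f \<le> x"
      using row_insert_hd_le[OF rs'(1)] by blast
    have "f \<in> insert x (set rs)"
      using row_insert_set[OF rs'(1)] f by auto
    then have "h \<le> f"
      using False Cons.prems(2) by auto
    moreover have "f < y"
      using row_insert_bumped[OF rs'(1)] f by auto
    ultimately have *: "knuth ([] @ [h, y, f] @ fs) ([] @ [y, h, f] @ fs)"
      by (intro knuth_of_step knuth_step.intros)
    have "knuth ([h] @ (rs @ [x])) ([h] @ (y # rs'))"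
      by (intro knuth_append_left Cons.IH) (use Cons.prems rs' in auto)
    also have "knuth ([h] @ (y # rs')) (y # r')"
      using * f rs' by simp
    finally show ?thesis by simp
  qed
qed auto

section \<open>Tableau insertion\<close>

lemma tableau_insert_sorted_rows:
  "\<forall>r \<in> set t. sorted r \<Longrightarrow> \<forall>r \<in> set (tableau_insert x t). sorted r"
  by (induction x t rule: tableau_insert.induct)
    (auto split: prod.splits option.splits dest: row_insert_sorted[OF sym])

lemma P_symbol_snoc: "P_symbol (w @ [x]) = tableau_insert x (P_symbol w)"
  by (simp add: P_symbol_def)

lemma P_symbol_sorted_rows: "r \<in> set (P_symbol w) \<Longrightarrow> sorted r"
proof (induction w arbitrary: r rule: rev_induct)
  case (snoc x w)
  then show ?case using tableau_insert_sorted_rows[of "P_symbol w" x]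
    by (auto simp: P_symbol_snoc)
qed (simp add: P_symbol_def)

text \<open>The reading word \<open>concat (rev t)\<close> takes the first row last. Bumping puts
  \<open>y\<close> in front of the new first row, hence right behind the reading word of the
  remaining rows, into which it is inserted next.\<close>

lemma knuth_tableau_insert:
  assumes "\<forall>r \<in> set t. sorted r"
  shows "knuth (concat (rev t) @ [x]) (concat (rev (tableau_insert x t)))"
  using assms
proof (induction t arbitrary: x)
  case (Cons r rs)
  obtain r' b where r': "row_insert x r = (r', b)" by fastforce
  show ?case
  proof (cases b)
    case None
    then show ?thesis using r' row_insert_None[of x r r'] by (auto intro: knuth_refl)
  next
    case (Some y)
    have "knuth (concat (rev rs) @ (r @ [x])) (concat (rev rs) @ (y # r'))"
      by (intro knuth_append_left knuth_row_insert) (use Cons.prems r' Some in auto)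
    also have "knuth ((concat (rev rs) @ [y]) @ r') (concat (rev (tableau_insert y rs)) @ r')"
      by (intro knuth_append_right Cons.IH) (use Cons.prems in auto)
    then have "knuth (concat (rev rs) @ (y # r')) (concat (rev (tableau_insert x (r # rs))))"
      using r' Some by simp
    finally show ?thesis by simp
  qed
qed (auto intro: knuth_refl)

lemma knuth_P_symbol: "knuth w (concat (rev (P_symbol w)))"
proof (induction w rule: rev_induct)
  case (snoc x w)
  have "knuth (w @ [x]) (concat (rev (P_symbol w)) @ [x])"
    by (intro knuth_append_right snoc)
  also have "knuth \<dots> (concat (rev (tableau_insert x (P_symbol w))))"
    by (intro knuth_tableau_insert) (simp add: P_symbol_sorted_rows)
  finally show ?case by (simp add: P_symbol_snoc)
qed (auto simp: P_symbol_def intro: knuth_refl)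

section \<open>Invariance of the insertion tableau under the Knuth relations\<close>

fun row_insert_word :: "'a::linorder list \<Rightarrow> 'a list \<Rightarrow> 'a list \<times> 'a list" where
  "row_insert_word [] r = (r, [])"
| "row_insert_word (x # u) r =
     (let (r', b) = row_insert x r; (r'', v) = row_insert_word u r'
      in (r'', case b of None \<Rightarrow> v | Some y \<Rightarrow> y # v))"

text \<open>The lower rows see only the word of entries bumped out of the first row, which reduces
  the invariance to a statement about a single row.\<close>

lemma fold_tableau_insert_Cons:
  "fold tableau_insert u (r # rs) =
     fst (row_insert_word u r) # fold tableau_insert (snd (row_insert_word u r)) rs"
  by (induction u arbitrary: r rs) (auto split: prod.splits option.splits)

text \<open>Successive insertions of \<open>y \<le> z\<close> take place at strictly increasing positions.\<close>
lemma row_insert_le_row_insert: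
  assumes "y \<le> z" "sorted r" "row_insert y r = (r1, b1)" "row_insert z r1 = (r2, b2)"
  shows "(b1 = None \<longrightarrow> b2 = None) \<and> (\<forall>p q. b1 = Some p \<longrightarrow> b2 = Some q \<longrightarrow> p \<le> q)"
  using assms(2-)
proof (induction r arbitrary: r1 r2)
  case Nil
  have "\<not> z < y" using assms(1) by auto
  with Nil show ?case by auto
next
  case (Cons h rs)
  show ?case
  proof (cases "y < h")
    case True
    have "\<not> z < y" using assms(1) by auto
    then obtain rs2 where "b1 = Some h" "row_insert z rs = (rs2, b2)"
      using True Cons.prems by (cases "row_insert z rs") auto
    then show ?thesis using Cons.prems(1) row_insert_bumped[of z rs rs2] by auto
  next
    case False
    then have "\<not> z < h" using assms(1) by auto
    obtain rs1 b where 1: "row_insert y rs = (rs1, b)" by fastforce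
    obtain rs2 c where 2: "row_insert z rs1 = (rs2, c)" by fastforce
    have "b = b1" "c = b2"
      using 1 2 False \<open>\<not> z < h\<close> Cons.prems by auto
    then show ?thesis using Cons.prems(1) Cons.IH 1 2 by auto
  qed
qed

text \<open>Once \<open>z\<close> is in the row, \<open>y\<close> bumps \<open>z\<close> or an entry
  to its left, and \<open>z\<close> passed those entries because they are at most
  \<open>z\<close>.\<close>

lemma row_insert_less_row_insert:
  assumes "y < z" "row_insert z r = (r1, b1)" "row_insert y r1 = (r2, b2)"
  shows "\<exists>q \<le> z. b2 = Some q"
  using assms(2-)
proof (induction r arbitrary: r1 r2 b1 b2)
  case Nil
  then show ?case using assms(1) by auto
next
  case (Cons h rs)
  obtain rs1 b where 1: "row_insert z rs = (rs1, b)" by fastforce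
  obtain rs2 c where 2: "row_insert y rs1 = (rs2, c)" by fastforce
  show ?case
  proof (cases "z < h")
    case True
    then show ?thesis using Cons.prems assms(1) by auto
  next
    case False
    then show ?thesis using Cons.prems Cons.IH[OF 1 2] 1 2 by (auto split: if_splits)
  qed
qed

text \<open>A head that no inserted letter can bump is inert. This settles the case
  \<open>h \<le> x\<close> in the inductions on a row for both Knuth relations.\<close>

lemma row_insert_word_Cons_le:
  assumes "\<forall>a \<in> set u. h \<le> a"
  shows "row_insert_word u (h # rs) = map_prod ((#) h) id (row_insert_word u rs)"
  using assms
proof (induction u arbitrary: rs)
  case (Cons a u)
  obtain rs' b where "row_insert a rs = (rs', b)" by fastforce
  moreover have "\<not> a < h" using Cons.prems by auto
  ultimately show ?case using Cons by (simp add: split_def Let_def split: option.splits)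
qed simp

text \<open>Knuth equivalence of the inserted triples is inherited by the bumped words, which is what
  makes the induction on the rows of a tableau work.\<close>
definition same_row_knuth_bumped :: "'a::linorder list \<times> 'a list \<Rightarrow> 'a list \<times> 'a list \<Rightarrow> bool" where
  "same_row_knuth_bumped p q \<longleftrightarrow>
     fst p = fst q \<and> (snd p = snd q \<or> knuth_step (snd p) (snd q) \<or> knuth_step (snd q) (snd p))"

lemma row_insert_word_knuth_step1:
  assumes "x < y" "y \<le> z" "sorted r"
  shows "same_row_knuth_bumped (row_insert_word [y, x, z] r) (row_insert_word [y, z, x] r)"
  using assms(3)
proof (induction r)
  case Nil
  then show ?case using assms by (auto simp: same_row_knuth_bumped_def)
next
  case (Cons h rs)
  have rs: "sorted rs" "\<And>k. k \<in> set rs \<Longrightarrow> h \<le> k" using Cons.prems by auto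
  consider "h \<le> x" | "x < h" "h \<le> y" | "y < h" by force
  then show ?case
  proof cases
    case 1
    then have "row_insert_word u (h # rs) = map_prod ((#) h) id (row_insert_word u rs)"
      if "set u = {x, y, z}" for u
      using assms that by (intro row_insert_word_Cons_le) auto
    from this[of "[y, x, z]"] this[of "[y, z, x]"] Cons.IH[OF rs(1)] show ?thesis
      by (simp add: same_row_knuth_bumped_def insert_commute del: row_insert_word.simps)
  next
    case 2
    obtain r1 b1 where r1: "row_insert y rs = (r1, b1)" by fastforce
    obtain r2 b2 where r2: "row_insert z r1 = (r2, b2)" by fastforce
    have n: "\<not> y < h" "\<not> z < h" "\<not> z < x" using 2 assms by auto
    have "row_insert_word [y, x, z] (h # rs) =
        (x # r2, (case b1 of None \<Rightarrow> [] | Some p \<Rightarrow> [p]) @ h # (case b2 of None \<Rightarrow> [] | Some q \<Rightarrow> [q]))"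
      using 2 n r1 r2 by (simp split: option.splits)
    moreover have "row_insert_word [y, z, x] (h # rs) =
        (x # r2, (case b1 of None \<Rightarrow> [] | Some p \<Rightarrow> [p]) @ (case b2 of None \<Rightarrow> [] | Some q \<Rightarrow> [q]) @ [h])"
      using 2 n r1 r2 by (simp split: option.splits)
    \<comment> \<open>The bumped words differ only if \<open>b1\<close> and \<open>b2\<close> are
      both entries, \<open>p\<close> and \<open>q\<close>. They are then \<open>p h q\<close> and
      \<open>p q h\<close>, a triple of the first kind by \<open>h < p \<le> q\<close>.\<close>
    moreover have "b1 = None \<Longrightarrow> b2 = None" "\<And>p q. b1 = Some p \<Longrightarrow> b2 = Some q \<Longrightarrow> p \<le> q"
      using row_insert_le_row_insert[OF \<open>y \<le> z\<close> rs(1) r1 r2] by auto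
    moreover have "h < p" if "b1 = Some p" for p
      using row_insert_bumped[of y rs r1 p] r1 that 2 by auto
    ultimately show ?thesis
      by (auto simp: same_row_knuth_bumped_def intro: knuth_step.intros
          simp del: row_insert_word.simps split: option.splits)
  next
    case 3
    obtain r1 b1 where r1: "row_insert z rs = (r1, b1)" by fastforce
    have n: "x < y" "\<not> z < y" "\<not> z < x" using 3 assms by auto
    have "row_insert_word [y, x, z] (h # rs) =
        (x # r1, h # y # (case b1 of None \<Rightarrow> [] | Some p \<Rightarrow> [p]))"
      using 3 n r1 by (simp split: option.splits)
    moreover have "row_insert_word [y, z, x] (h # rs) =
        (x # r1, h # (case b1 of None \<Rightarrow> [] | Some p \<Rightarrow> [p]) @ [y])"
      using 3 n r1 by (simp split: option.splits)
    \<comment> \<open>The bumped words \<open>h y p\<close> and \<open>h p y\<close> are a triple of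
      the first kind by \<open>y < h \<le> p\<close>.\<close>
    moreover have "h \<le> p" if "b1 = Some p" for p
      using row_insert_bumped[of z rs r1 p] r1 that rs by auto
    ultimately show ?thesis using 3
      by (auto simp: same_row_knuth_bumped_def intro: knuth_step.intros
          simp del: row_insert_word.simps split: option.splits)
  qed
qed

lemma row_insert_word_knuth_step2:
  assumes "x \<le> y" "y < z" "sorted r"
  shows "same_row_knuth_bumped (row_insert_word [x, z, y] r) (row_insert_word [z, x, y] r)"
  using assms(3)
proof (induction r)
  case Nil
  then show ?case using assms by (auto simp: same_row_knuth_bumped_def)
next
  case (Cons h rs)
  have rs: "sorted rs" "\<And>k. k \<in> set rs \<Longrightarrow> h \<le> k" using Cons.prems by auto
  have n: "\<not> y < x" "\<not> z < x" "x < z" "\<not> z < y" using assms by auto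
  consider "h \<le> x" | "x < h" "h \<le> z" | "z < h" by force
  then show ?case
  proof cases
    case 1
    then have "row_insert_word u (h # rs) = map_prod ((#) h) id (row_insert_word u rs)"
      if "set u = {x, y, z}" for u
      using assms that by (intro row_insert_word_Cons_le) auto
    from this[of "[x, z, y]"] this[of "[z, x, y]"] Cons.IH[OF rs(1)] show ?thesis
      by (simp add: same_row_knuth_bumped_def insert_commute del: row_insert_word.simps)
  next
    case 2
    obtain r1 b1 where r1: "row_insert z rs = (r1, b1)" by fastforce
    obtain r2 b2 where r2: "row_insert y r1 = (r2, b2)" by fastforce
    obtain q where q: "b2 = Some q" "q \<le> z"
      using row_insert_less_row_insert[OF \<open>y < z\<close> r1 r2] by blast
    have "\<not> z < h" using 2 by auto
    have "row_insert_word [x, z, y] (h # rs) =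
        (x # r2, h # (case b1 of None \<Rightarrow> [] | Some p \<Rightarrow> [p]) @ [q])"
      using 2 n r1 r2 q by (simp split: option.splits)
    moreover have "row_insert_word [z, x, y] (h # rs) =
        (x # r2, (case b1 of None \<Rightarrow> [] | Some p \<Rightarrow> [p]) @ [h, q])"
      using 2 n r1 r2 q \<open>\<not> z < h\<close> by (simp split: option.splits)
    \<comment> \<open>If \<open>z\<close> bumps some \<open>p\<close>, the bumped words
      \<open>h p q\<close> and \<open>p h q\<close> are a triple of the second kind by
      \<open>h \<le> q < p\<close>; otherwise they are equal.\<close>
    moreover have "q \<in> insert z (set rs)"
      using row_insert_bumped[of y r1 r2 q] row_insert_set[OF r1] r2 q by auto
    then have "h \<le> q" using rs 2 by auto
    moreover have "q < p" if "b1 = Some p" for p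
      using row_insert_bumped[of z rs r1 p] r1 that q by auto
    ultimately show ?thesis
      by (auto simp: same_row_knuth_bumped_def intro: knuth_step.intros
          simp del: row_insert_word.simps split: option.splits)
  next
    case 3
    show ?thesis
    proof (cases rs)
      case Nil
      then show ?thesis using 3 n assms by (auto simp: same_row_knuth_bumped_def)
    next
      case (Cons k ks)
      then have k: "z < h" "h \<le> k" "z < k" "y < k" "x < h" using 3 rs assms by force+
      \<comment> \<open>A step of the second kind turns into one of the first kind read backwards,
        by \<open>z < h \<le> k\<close>; this is why \<open>same_row_knuth_bumped\<close> admits
        both directions.\<close>
      have "row_insert_word [x, z, y] (h # rs) = (x # y # ks, [h, k, z])"
        using k n Cons \<open>y < z\<close> by simp
      moreover have "row_insert_word [z, x, y] (h # rs) = (x # y # ks, [h, z, k])"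
        using k n Cons by simp
      ultimately show ?thesis using k
        by (auto simp: same_row_knuth_bumped_def intro: knuth_step.intros
          simp del: row_insert_word.simps)
    qed
  qed
qed

lemma row_insert_word_knuth_step:
  "knuth_step u v \<Longrightarrow> sorted r \<Longrightarrow>
    same_row_knuth_bumped (row_insert_word u r) (row_insert_word v r)"
  by (auto elim!: knuth_step.cases
      intro: row_insert_word_knuth_step1 row_insert_word_knuth_step2 simp del: row_insert_word.simps)

lemma fold_tableau_insert_knuth_step:
  assumes "knuth_step u v" "\<forall>r \<in> set t. sorted r"
  shows "fold tableau_insert u t = fold tableau_insert v t"
  using assms
proof (induction t arbitrary: u v)
  case Nil
  then show ?case by (auto elim!: knuth_step.cases)
next
  case (Cons r rs)
  then show ?case
    using row_insert_word_knuth_step[of u v r]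
    by (auto simp: fold_tableau_insert_Cons same_row_knuth_bumped_def simp del: fold.simps)
qed

lemma P_symbol_cong_knuth: "knuth u v \<Longrightarrow> P_symbol u = P_symbol v"
proof (induction rule: knuth.induct)
  case (knuth_of_step u v p q)
  then show ?case
    using fold_tableau_insert_knuth_step[of u v "P_symbol p"] P_symbol_sorted_rows[of _ p]
    by (auto simp: P_symbol_def)
qed auto

text \<open>For the converse of the invariance, two words with the same tableau are both equivalent
  to its reading word.\<close>

lemma P_symbol_eq_iff_knuth: "P_symbol u = P_symbol v \<longleftrightarrow> knuth u v"
  using P_symbol_cong_knuth knuth_P_symbol[of u] knuth_P_symbol[of v]
  by (metis knuth_sym knuth_trans)

section \<open>Insertion tableaux of permutations are standard\<close>

text \<open>The column condition between a row and the one below it, in a recursive form that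
  follows \<open>row_insert\<close>. By the second equation the lower row cannot be longer.\<close>

fun column_dominates :: "'a::linorder list \<Rightarrow> 'a list \<Rightarrow> bool" where
  "column_dominates r [] = True"
| "column_dominates [] (k # ks) = False"
| "column_dominates (h # hs) (k # ks) = (h < k \<and> column_dominates hs ks)"

lemma column_dominates_iff:
  "column_dominates r s \<longleftrightarrow> length s \<le> length r \<and> (\<forall>j < length s. r ! j < s ! j)"
  by (induction r s rule: column_dominates.induct) (auto simp: less_Suc_eq_0_disj)

text \<open>Insertion changes the upper row only by making an entry smaller or by appending
  one.\<close>

lemma column_dominates_row_insert_left:
  "row_insert x r = (r', b) \<Longrightarrow> column_dominates r s \<Longrightarrow> column_dominates r' s"
proof (induction r s arbitrary: r' rule: column_dominates.induct)
  case (3 h hs k ks)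
  then show ?case by (force split: if_splits prod.splits)
qed auto

text \<open>If \<open>y\<close> left position \<open>p\<close> of \<open>r\<close>, the entry of
  \<open>s\<close> below it, if any, exceeds \<open>y\<close>, so \<open>y\<close> enters
  \<open>s\<close> at \<open>p\<close> or further left. The entries of \<open>r'\<close> up to
  \<open>p\<close> are at most \<open>x\<close>, hence less than \<open>y\<close>.\<close>

lemma column_dominates_row_insert:
  assumes "row_insert x r = (r', Some y)" "row_insert y s = (s', b)"
    "sorted r" "column_dominates r s"
  shows "column_dominates r' s'"
  using assms
proof (induction r s arbitrary: r' s' rule: column_dominates.induct)
  case (1 r)
  then show ?case
    using row_insert_hd_le[OF 1(1)] row_insert_bumped[OF 1(1)] by auto
next
  case (3 h hs k ks)
  show ?case
  proof (cases "x < h")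
    case True
    then show ?thesis using 3 by auto
  next
    case False
    then obtain rs' where rs': "row_insert x hs = (rs', Some y)" "r' = h # rs'"
      using "3.prems" by (auto split: prod.splits)
    show ?thesis
    proof (cases "y < k")
      case True
      moreover have "h < y" using row_insert_bumped[OF rs'(1)] False by auto
      ultimately show ?thesis
        using "3.prems" rs' column_dominates_row_insert_left[OF rs'(1)] by auto
    next
      case False
      then obtain ss' where ss': "row_insert y ks = (ss', b)" "s' = k # ss'"
        using "3.prems" by (auto split: prod.splits)
      then show ?thesis using 3 rs' by auto
    qed
  qed
qed auto

lemma tableau_insert_neq_Nil: "tableau_insert x t \<noteq> []"
  by (cases t) (auto split: prod.splits option.splits)

lemma row_insert_neq_Nil: "row_insert x r = (r', b) \<Longrightarrow> r' \<noteq> []"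
  using row_insert_hd_le by fastforce

lemma tableau_insert_no_empty_row: "[] \<notin> set t \<Longrightarrow> [] \<notin> set (tableau_insert x t)"
proof (induction t arbitrary: x)
  case (Cons r rs)
  obtain r' b where "row_insert x r = (r', b)" by fastforce
  then show ?case using Cons row_insert_neq_Nil[of x r r' b] by (auto split: option.splits)
qed auto

text \<open>Treating a missing row as empty lets \<open>column_dominates_row_insert\<close> cover
  the case of a bumped entry that opens a new row.\<close>

lemma hd_tableau_insert:
  "hd (tableau_insert x t) = fst (row_insert x (case t of [] \<Rightarrow> [] | r # rs \<Rightarrow> r))"
  by (cases t) (auto split: prod.splits option.splits)

lemma tableau_insert_columns:
  assumes "successively column_dominates t" "\<forall>r \<in> set t. sorted r"
  shows "successively column_dominates (tableau_insert x t)"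
  using assms
proof (induction t arbitrary: x)
  case (Cons r rs)
  obtain r' b where r': "row_insert x r = (r', b)" by fastforce
  show ?case
  proof (cases b)
    case None
    then show ?thesis
      using r' Cons.prems column_dominates_row_insert_left[OF r'] by (auto simp: successively_Cons)
  next
    case (Some y)
    have "column_dominates r (case rs of [] \<Rightarrow> [] | s # _ \<Rightarrow> s)"
      using Cons.prems by (auto split: list.splits)
    then have "column_dominates r' (hd (tableau_insert y rs))"
      using column_dominates_row_insert[OF r'[unfolded Some]] Cons.prems
      by (simp add: hd_tableau_insert) (metis prod.collapse)
    moreover have "successively column_dominates (tableau_insert y rs)"
      using Cons by (auto simp: successively_Cons)
    ultimately show ?thesis
      using r' Some tableau_insert_neq_Nil by (auto simp: successively_Cons)
  qed
qed auto

lemma mset_concat_tableau_insert: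
  "mset (concat (tableau_insert x t)) = add_mset x (mset (concat t))"
proof (induction t arbitrary: x)
  case (Cons r rs)
  obtain r' b where r': "row_insert x r = (r', b)" by fastforce
  show ?case
    using r' row_insert_mset[OF r'] Cons by (cases b) auto
qed auto

lemma mset_concat_P_symbol: "mset (concat (P_symbol w)) = mset w"
  by (induction w rule: rev_induct)
    (simp_all only: P_symbol_snoc mset_concat_tableau_insert, simp_all add: P_symbol_def)

lemma length_concat_P_symbol: "length (concat (P_symbol w)) = length w"
  using mset_concat_P_symbol by (metis size_mset)

lemma P_symbol_eq_Nil_iff: "P_symbol w = [] \<longleftrightarrow> w = []"
  by (cases w rule: rev_cases) (simp_all add: P_symbol_snoc tableau_insert_neq_Nil, simp add: P_symbol_def)

text \<open>Shape and columns come from \<open>column_dominates\<close> on consecutive rows, the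
  contents from the multiset of entries, and strictness of rows from sortedness and
  distinctness.\<close>

lemma standard_tableau_P_symbol:
  assumes "distinct w" "set w = {1..length w}"
  shows "standard_tableau (P_symbol w)"
proof -
  let ?t = "P_symbol w"
  have "[] \<notin> set ?t"
    by (induction w rule: rev_induct)
      (auto simp: P_symbol_snoc P_symbol_def[of "[]"] tableau_insert_no_empty_row)
  moreover have cols: "successively column_dominates ?t"
    by (induction w rule: rev_induct)
      (auto simp: P_symbol_snoc P_symbol_def[of "[]"] tableau_insert_columns P_symbol_sorted_rows)
  moreover have "sorted_wrt (\<ge>) (map length ?t)"
  proof -
    have "successively (\<ge>) (map length ?t)"
      unfolding successively_map
      using cols by (rule successively_mono) (auto simp: column_dominates_iff)
    then show ?thesis by (subst (asm) successively_conv_sorted_wrt) (auto simp: transp_def)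
  qed
  moreover have dist: "distinct (concat ?t)"
    using assms(1) mset_concat_P_symbol[of w] by (metis mset_eq_imp_distinct_iff)
  moreover have "set (concat ?t) = {1..length (concat ?t)}"
    using assms(2) mset_concat_P_symbol[of w] length_concat_P_symbol[of w] by (metis mset_eq_setD)
  moreover have "sorted_wrt (<) r" if "r \<in> set ?t" for r
  proof -
    have "distinct r"
      using dist that by (metis distinct_append concat_append concat.simps(2) split_list)
    then show ?thesis using P_symbol_sorted_rows[OF that] by (simp add: strict_sorted_iff)
  qed
  moreover have "?t ! i ! j < ?t ! Suc i ! j" if "Suc i < length ?t" "j < length (?t ! Suc i)" for i j
    using cols that by (auto simp: successively_conv_nth column_dominates_iff)
  ultimately show ?thesis unfolding standard_tableau_def by blast
qed

section \<open>Words and their inverse standardization\<close>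

text \<open>Read as a word, the inverse of \<open>std w\<close> lists the positions of \<open>w\<close> (counted from 1) by
  increasing letter, equal letters from left to right; this is what a stable sort produces.\<close>
definition inv_std :: "'a::linorder list \<Rightarrow> nat list" where
  "inv_std w = sort_key (\<lambda>i. w ! (i - 1)) [1..<Suc (length w)]"

lemma length_inv_std [simp]: "length (inv_std w) = length w"
  by (simp add: inv_std_def del: upt_Suc)

lemma set_inv_std: "set (inv_std w) = {1..length w}"
  by (simp add: inv_std_def atLeastLessThanSuc_atLeastAtMost del: upt_Suc)

lemma distinct_inv_std: "distinct (inv_std w)"
  by (simp add: inv_std_def)

lemma insort_key_map: "insort_key f (g x) (map g xs) = map g (insort_key (\<lambda>y. f (g y)) x xs)"
  by (induction xs) auto

lemma sort_key_map: "sort_key f (map g xs) = map g (sort_key (\<lambda>y. f (g y)) xs)"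
  by (induction xs) (auto simp: insort_key_map)

lemma insort_key_cong:
  "f x = g x \<Longrightarrow> (\<And>y. y \<in> set xs \<Longrightarrow> f y = g y) \<Longrightarrow> insort_key f x xs = insort_key g x xs"
  by (induction xs) auto

lemma sort_key_cong: "(\<And>y. y \<in> set xs \<Longrightarrow> f y = g y) \<Longrightarrow> sort_key f xs = sort_key g xs"
  by (induction xs) (auto intro: insort_key_cong)

text \<open>Stable sorting commutes with filtering, and the positions that the filter keeps are
  \<open>1\<close>, ..., \<open>k\<close> shifted by \<open>m\<close>.\<close>

lemma inv_std_factor:
  assumes "m + k \<le> length w"
  shows "map (\<lambda>i. i + m) (inv_std (take k (drop m w))) =
    filter (\<lambda>i. m < i \<and> i \<le> m + k) (inv_std w)"
proof -
  have "filter (\<lambda>i. m < i \<and> i \<le> m + k) [1..<Suc (length w)] = [Suc m..<Suc (m + k)]"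
  proof (rule sorted_distinct_set_unique)
    show "set (filter (\<lambda>i. m < i \<and> i \<le> m + k) [1..<Suc (length w)]) = set [Suc m..<Suc (m + k)]"
      using assms by auto
  qed (auto intro: sorted_wrt_filter simp del: upt_Suc)
  also have "\<dots> = map (\<lambda>i. i + m) [1..<Suc k]"
    by (rule nth_equalityI) (auto simp del: upt_Suc)
  finally have "filter (\<lambda>i. m < i \<and> i \<le> m + k) (inv_std w) =
      sort_key (\<lambda>i. w ! (i - 1)) (map (\<lambda>i. i + m) [1..<Suc k])"
    by (simp only: inv_std_def filter_sort)
  also have "\<dots> = map (\<lambda>i. i + m) (sort_key (\<lambda>i. w ! (i + m - 1)) [1..<Suc k])"
    by (rule sort_key_map)
  also have "sort_key (\<lambda>i. w ! (i + m - 1)) [1..<Suc k] =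
      sort_key (\<lambda>i. take k (drop m w) ! (i - 1)) [1..<Suc k]"
    using assms by (intro sort_key_cong) (auto simp del: upt_Suc simp: add.commute)
  also have "\<dots> = inv_std (take k (drop m w))"
    using assms by (simp add: inv_std_def)
  finally show ?thesis by simp
qed

text \<open>Passing to a factor keeps an interval of values in \<open>inv_std w\<close> and shifts
  it back by \<open>m\<close>; both operations respect Knuth equivalence.\<close>

lemma P_symbol_inv_std_factor:
  fixes w w' :: "'a::linorder list"
  assumes "P_symbol (inv_std w) = P_symbol (inv_std w')" "m + k \<le> length w"
  shows "P_symbol (inv_std (take k (drop m w))) = P_symbol (inv_std (take k (drop m w')))"
proof -
  let ?Q = "\<lambda>i. m < i \<and> i \<le> m + k"
  have len: "length w' = length w"
    using assms(1) length_concat_P_symbol[of "inv_std w"] length_concat_P_symbol[of "inv_std w'"]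
    by simp
  have "knuth (filter ?Q (inv_std w)) (filter ?Q (inv_std w'))"
    using assms(1) by (intro knuth_filter) (auto simp: P_symbol_eq_iff_knuth)
  then have "knuth (map (\<lambda>i. i - m) (filter ?Q (inv_std w)))
      (map (\<lambda>i. i - m) (filter ?Q (inv_std w')))"
    by (rule knuth_map) (auto simp: strict_mono_on_def)
  moreover have "map (\<lambda>i. i - m) (filter ?Q (inv_std v)) = inv_std (take k (drop m v))"
    if "m + k \<le> length v" for v :: "'a list"
    by (simp add: inv_std_factor[OF that, symmetric] o_def)
  ultimately show ?thesis
    using assms(2) len by (simp add: P_symbol_eq_iff_knuth)
qed

section \<open>The stable sort as inverse of the standardization\<close>

lemma sorted_wrt_insort_key:
  fixes f :: "'b::linorder \<Rightarrow> 'a::linorder"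
  defines "R \<equiv> \<lambda>a b. f a < f b \<or> f a = f b \<and> a < b"
  assumes "sorted_wrt R ys" "\<forall>y \<in> set ys. x < y"
  shows "sorted_wrt R (insort_key f x ys)"
  using assms(2,3)
proof (induction ys)
  case (Cons y ys)
  show ?case
  proof (cases "f x \<le> f y")
    case True
    have "R x z" if "z \<in> set (y # ys)" for z
      using Cons.prems that True by (force simp: R_def)
    then show ?thesis using True Cons.prems by auto
  next
    case False
    then have "R y x" by (auto simp: R_def)
    then show ?thesis using False Cons by (auto simp: set_insort_key)
  qed
qed simp

text \<open>The tie-break expresses stability: elements are inserted from the last to the first,
  each in front of those with the same key.\<close>

lemma sorted_wrt_sort_key:
  fixes f :: "'b::linorder \<Rightarrow> 'a::linorder"
  assumes "sorted_wrt (<) xs"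
  shows "sorted_wrt (\<lambda>a b. f a < f b \<or> f a = f b \<and> a < b) (sort_key f xs)"
  using assms by (induction xs) (auto intro!: sorted_wrt_insort_key)

text \<open>The list \<open>inv_std w\<close> is increasing for the order \<open>R\<close> by which
  \<open>standardization\<close> counts, so exactly the indices up to \<open>k\<close> hold
  positions counted for \<open>i\<close>. Positions are counted from 1 in \<open>inv_std w\<close>,
  while list indices start at 0.\<close>

lemma standardization_inv_std:
  assumes "k < length w" "inv_std w ! k = Suc i"
  shows "standardization w ! i = Suc k"
proof -
  define R where "R = (\<lambda>a b. w ! (a - 1) < w ! (b - 1) \<or> w ! (a - 1) = w ! (b - 1) \<and> a < b)"
  let ?L = "inv_std w"
  have i: "i < length w"
    using assms set_inv_std[of w] nth_mem[of k ?L] by auto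
  have L: "sorted_wrt R ?L"
    unfolding inv_std_def R_def by (rule sorted_wrt_sort_key) (simp del: upt_Suc)
  have R_iff: "R (?L ! l) (?L ! k) \<or> ?L ! l = ?L ! k \<longleftrightarrow> l \<le> k" if "l < length w" for l
  proof (cases l k rule: linorder_cases)
    case less
    then show ?thesis using sorted_wrt_nth_less[OF L, of l k] assms by simp
  next
    case greater
    then have "R (?L ! k) (?L ! l)" using sorted_wrt_nth_less[OF L, of k l] that by simp
    then have "\<not> R (?L ! l) (?L ! k)" "?L ! l \<noteq> ?L ! k" by (auto simp: R_def)
    with greater show ?thesis by simp
  qed simp
  have "Suc ` {j. j < length w \<and> (w ! j < w ! i \<or> w ! j = w ! i \<and> j \<le> i)} =
      {a \<in> {1..length w}. R a (Suc i) \<or> a = Suc i}"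
  proof (intro set_eqI iffI)
    fix a assume "a \<in> {a \<in> {1..length w}. R a (Suc i) \<or> a = Suc i}"
    then show "a \<in> Suc ` {j. j < length w \<and> (w ! j < w ! i \<or> w ! j = w ! i \<and> j \<le> i)}"
      by (intro image_eqI[of _ _ "a - 1"]) (auto simp: R_def)
  qed (auto simp: R_def)
  also have "\<dots> = (!) ?L ` {l. l < length w \<and> l \<le> k}"
    unfolding set_inv_std[symmetric] assms(2)[symmetric] using R_iff
    by (auto simp: in_set_conv_nth)
  also have "{l. l < length w \<and> l \<le> k} = {..k}" using assms by auto
  finally have "card (Suc ` {j. j < length w \<and> (w ! j < w ! i \<or> w ! j = w ! i \<and> j \<le> i)}) =
      card ((!) ?L ` {..k})" by simp
  also have "\<dots> = Suc k"
    using assms by (subst card_image) (auto intro: inj_on_nth distinct_inv_std)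
  finally show ?thesis
    using i by (simp add: card_image standardization_def)
qed

lemma inv_std_obtain:
  assumes "i < length w"
  obtains k where "k < length w" "inv_std w ! k = Suc i" "standardization w ! i = Suc k"
proof -
  have "Suc i \<in> set (inv_std w)" using assms by (auto simp: set_inv_std)
  then obtain k where "k < length w" "inv_std w ! k = Suc i" by (auto simp: in_set_conv_nth)
  then show thesis using that standardization_inv_std by blast
qed

section \<open>Permutations and their words\<close>

lemma perm_word_eq_iff:
  "perm_word n \<sigma> = xs \<longleftrightarrow> length xs = n \<and> (\<forall>k < n. \<sigma> (Suc k) = xs ! k)"
  by (auto simp: perm_word_def list_eq_iff_nth_eq simp del: upt_Suc)

text \<open>Read as maps, \<open>standardization w\<close> and \<open>inv_std w\<close> are inverse
  to each other, so each equation is obtained from the other by inverting both sides.\<close>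

lemma perm_word_inv_eq_standardization_iff:
  assumes "\<sigma> permutes {1..n}"
  shows "perm_word n (inv \<sigma>) = standardization w \<longleftrightarrow> perm_word n \<sigma> = inv_std w"
proof -
  have inv: "inv \<sigma> (Suc i) = Suc k \<longleftrightarrow> \<sigma> (Suc k) = Suc i" for i k
    using permutes_inv_eq[OF assms] by auto
  have *: "(\<forall>i < length w. inv \<sigma> (Suc i) = standardization w ! i) \<longleftrightarrow>
      (\<forall>k < length w. \<sigma> (Suc k) = inv_std w ! k)"
  proof (intro iffI allI impI)
    fix k assume std: "\<forall>i < length w. inv \<sigma> (Suc i) = standardization w ! i" and k: "k < length w"
    obtain i where i: "inv_std w ! k = Suc i" "i < length w"
      using set_inv_std[of w] nth_mem[of k "inv_std w"] k by (cases "inv_std w ! k") auto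
    then have "inv \<sigma> (Suc i) = Suc k"
      using std standardization_inv_std[OF k] by simp
    then show "\<sigma> (Suc k) = inv_std w ! k" using inv i by simp
  next
    fix i assume \<sigma>: "\<forall>k < length w. \<sigma> (Suc k) = inv_std w ! k" and i: "i < length w"
    obtain k where "k < length w" "inv_std w ! k = Suc i" "standardization w ! i = Suc k"
      using inv_std_obtain[OF i] by blast
    then show "inv \<sigma> (Suc i) = standardization w ! i" using \<sigma> inv by simp
  qed
  have "length (standardization w) = length w" by (simp add: standardization_def)
  with * show ?thesis by (auto simp: perm_word_eq_iff)
qed

text \<open>The word fixes the values on \<open>{1..length w}\<close>, and \<open>permutes\<close>
  forces the identity elsewhere.\<close>

lemma ex1_perm_word_eq_inv_std:
  "\<exists>!\<sigma>. \<sigma> permutes {1..length w} \<and> perm_word (length w) \<sigma> = inv_std w"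
proof (rule ex1I)
  let ?\<sigma> = "\<lambda>i. if i \<in> {1..length w} then inv_std w ! (i - 1) else i"
  have "bij_betw ((!) (inv_std w) \<circ> (\<lambda>i. i - 1)) {1..length w} {1..length w}"
  proof (rule bij_betw_trans)
    show "bij_betw (\<lambda>i. i - 1) {1..length w} {..<length w}"
      by (rule bij_betw_byWitness[where f' = Suc]) auto
    show "bij_betw ((!) (inv_std w)) {..<length w} {1..length w}"
      by (rule bij_betw_nth) (auto simp: distinct_inv_std set_inv_std)
  qed
  then have "bij_betw ?\<sigma> {1..length w} {1..length w}"
    by (rule bij_betw_cong[THEN iffD1, rotated]) simp
  then have "?\<sigma> permutes {1..length w}"
    by (rule bij_imp_permutes) auto
  then show "?\<sigma> permutes {1..length w} \<and> perm_word (length w) ?\<sigma> = inv_std w"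
    by (auto simp: perm_word_eq_iff)
  fix \<tau> assume \<tau>: "\<tau> permutes {1..length w} \<and> perm_word (length w) \<tau> = inv_std w"
  show "\<tau> = ?\<sigma>"
  proof
    fix i show "\<tau> i = ?\<sigma> i"
      using \<tau> by (cases i) (auto simp: perm_word_eq_iff permutes_not_in)
  qed
qed

section \<open>Coefficients of \<open>S t\<close>\<close>

lemma sum_fun_apply: "(\<Sum>a \<in> A. f a) x = (\<Sum>a \<in> A. f a x)" for f :: "'b \<Rightarrow> 'c \<Rightarrow> 'd::comm_monoid_add"
  by (induction A rule: infinite_finite_induct) auto

text \<open>A word \<open>w\<close> occurs in \<open>F n \<sigma>\<close> iff
  \<open>\<sigma>\<close> has the word \<open>inv_std w\<close>. Exactly one permutation of the
  right size has it, and it is among the summands iff its tableau is \<open>t\<close>.\<close>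

lemma S_apply:
  "(S t :: ('a::linorder, 'k::field) series) w = (if P_symbol (inv_std w) = t then 1 else 0)"
proof -
  let ?n = "length (concat t)"
  let ?A = "{\<sigma>. \<sigma> permutes {1..?n} \<and> P_symbol (perm_word ?n \<sigma>) = t}"
  have "(S t :: ('a, 'k) series) w = (\<Sum>\<sigma> \<in> ?A. if perm_word ?n \<sigma> = inv_std w then 1 else 0)"
    unfolding S_def Let_def sum_fun_apply
  proof (rule sum.cong)
    fix \<sigma> assume "\<sigma> \<in> ?A"
    then have "standardization w = perm_word ?n (inv \<sigma>) \<longleftrightarrow> perm_word ?n \<sigma> = inv_std w"
      using perm_word_inv_eq_standardization_iff[of \<sigma> ?n w] by auto
    then show "(F ?n \<sigma> :: ('a, 'k) series) w = (if perm_word ?n \<sigma> = inv_std w then 1 else 0)"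
      by (simp add: F_def G_def)
  qed simp
  also have "\<dots> = (if P_symbol (inv_std w) = t then 1 else 0)"
  proof (cases "P_symbol (inv_std w) = t")
    case True
    then have n: "?n = length w" using length_concat_P_symbol[of "inv_std w"] by simp
    obtain \<sigma>0 where \<sigma>0: "\<sigma>0 permutes {1..?n}" "perm_word ?n \<sigma>0 = inv_std w"
      and unique: "\<forall>\<sigma>. \<sigma> permutes {1..?n} \<and> perm_word ?n \<sigma> = inv_std w \<longrightarrow> \<sigma> = \<sigma>0"
      using ex1_perm_word_eq_inv_std[of w, folded n] unfolding Ex1_def by blast
    have fin: "finite ?A"
      by (rule finite_subset[OF _ finite_permutations[of "{1..?n}"]]) auto
    have "(\<Sum>\<sigma> \<in> ?A. if perm_word ?n \<sigma> = inv_std w then 1 else 0) =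
        (\<Sum>\<sigma> \<in> ?A. if \<sigma> = \<sigma>0 then 1 else (0::'k))"
    proof (rule sum.cong)
      fix \<sigma> assume "\<sigma> \<in> ?A"
      then have "perm_word ?n \<sigma> = inv_std w \<longleftrightarrow> \<sigma> = \<sigma>0"
        using \<sigma>0 unique by blast
      then show "(if perm_word ?n \<sigma> = inv_std w then 1 else 0) = (if \<sigma> = \<sigma>0 then 1 else (0::'k))"
        by simp
    qed simp
    also have "\<dots> = (if \<sigma>0 \<in> ?A then 1 else 0)"
      using fin by (rule sum.delta)
    finally show ?thesis using \<sigma>0 True by simp
  next
    case False
    then have "perm_word ?n \<sigma> \<noteq> inv_std w" if "\<sigma> \<in> ?A" for \<sigma>
      using that by auto
    then show ?thesis using False by (simp add: sum.neutral)
  qed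
  finally show ?thesis .
qed

section \<open>The sharp product\<close>

lemma sharp_words_eq_Some_iff:
  "sharp_words p q = Some w \<longleftrightarrow> (\<exists>i < length w. p = take (Suc i) w \<and> q = drop i w)"
proof
  assume *: "sharp_words p q = Some w"
  then have "p \<noteq> []" "q \<noteq> []" by (auto simp: sharp_words_def split: if_splits)
  then obtain u x y v where "p = u @ [x]" "q = y # v"
    by (metis neq_Nil_conv rev_exhaust)
  with * show "\<exists>i < length w. p = take (Suc i) w \<and> q = drop i w"
    by (intro exI[of _ "length u"]) (auto simp: sharp_words_snoc_Cons split: if_splits)
next
  assume "\<exists>i < length w. p = take (Suc i) w \<and> q = drop i w"
  then obtain i where i: "i < length w" "p = take (Suc i) w" "q = drop i w" by blast
  have "p = take i w @ [w ! i]" "q = w ! i # drop (Suc i) w"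
    using i by (auto simp: take_Suc_conv_app_nth Cons_nth_drop_Suc)
  then show "sharp_words p q = Some w"
    using i by (simp add: sharp_words_snoc_Cons id_take_nth_drop[symmetric])
qed

text \<open>A factorization of \<open>w\<close> is determined by the index \<open>i\<close> of the
  letter shared by the two factors, so the sum over pairs becomes a sum over indices.\<close>

lemma sharp_apply:
  "(f \<sharp> g) w = (\<Sum>i < length w. f (take (Suc i) w) * g (drop i w))"
proof -
  have "{(p, q). sharp_words p q = Some w} = (\<lambda>i. (take (Suc i) w, drop i w)) ` {..<length w}"
    by (auto simp: sharp_words_eq_Some_iff)
  moreover have "inj_on (\<lambda>i. (take (Suc i) w, drop i w)) {..<length w}"
  proof (rule inj_onI)
    fix i j assume "i \<in> {..<length w}" "j \<in> {..<length w}"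
      "(take (Suc i) w, drop i w) = (take (Suc j) w, drop j w)"
    then have "length (drop i w) = length (drop j w)" "i < length w" "j < length w" by auto
    then show "i = j" by simp
  qed
  ultimately show ?thesis by (simp add: sharp_def sum.reindex)
qed

lemma sharp_linear:
  shows sharp_zero_left: "0 \<sharp> g = 0"
    and sharp_zero_right: "f \<sharp> 0 = 0"
    and sharp_add_left: "(f + f') \<sharp> g = f \<sharp> g + f' \<sharp> g"
    and sharp_add_right: "f \<sharp> (g + g') = f \<sharp> g + f \<sharp> g'"
    and sharp_scale_left: "series_scale c f \<sharp> g = series_scale c (f \<sharp> g)"
    and sharp_scale_right: "f \<sharp> series_scale c g = series_scale c (f \<sharp> g)"
  by (auto simp: fun_eq_iff sharp_apply series_scale_def sum.distrib sum_distrib_left algebra_simps)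

lemma S_sharp_S_in_FSym:
  assumes "t' \<noteq> []"
  shows "S t' \<sharp> S t'' \<in> (FSym :: ('a::linorder, 'k::field) series set)"
proof -
  interpret vector_space "series_scale :: 'k \<Rightarrow> ('a, 'k) series \<Rightarrow> _"
    by (rule vector_space_series)
  \<comment> \<open>A prefix with recording tableau \<open>t'\<close> has as many letters as
    \<open>t'\<close> has entries, so the shared letter can only stand at index \<open>m\<close>,
    counted from 0.\<close>
  define m where "m = length (concat t') - 1"
  define W where "W = {w :: 'a list. m < length w \<and>
    P_symbol (inv_std (take (Suc m) w)) = t' \<and> P_symbol (inv_std (drop m w)) = t''}"
  define T where "T = (\<lambda>w. P_symbol (inv_std w)) ` W"
  have coeff: "(S t' \<sharp> S t'' :: ('a, 'k) series) w = (if w \<in> W then 1 else 0)" for w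
  proof -
    have m: "i = m" if "i < length w" "P_symbol (inv_std (take (Suc i) w)) = t'" for i
      using that length_concat_P_symbol[of "inv_std (take (Suc i) w)"] by (simp add: m_def)
    have "(S t' \<sharp> S t'' :: ('a, 'k) series) w =
        (\<Sum>i < length w. if i = m then (if w \<in> W then 1 else 0) else 0)"
      unfolding sharp_apply
    proof (rule sum.cong)
      fix i assume "i \<in> {..<length w}"
      then show "S t' (take (Suc i) w) * S t'' (drop i w) =
          (if i = m then (if w \<in> W then 1 else 0) else (0::'k))"
        using m[of i] by (cases "i = m") (auto simp: S_apply W_def)
    qed simp
    then show ?thesis by (auto simp: W_def)
  qed
  have len: "length w = m + length (concat t'')" if "w \<in> W" for w
    using that length_concat_P_symbol[of "inv_std (drop m w)"] by (auto simp: W_def)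
  \<comment> \<open>All words of \<open>W\<close> have the same length, so their inverse
    standardizations are words of fixed length over a finite set of numbers, and only finitely many
    tableaux arise.\<close>
  have "T \<subseteq> P_symbol ` {xs. set xs \<subseteq> {1..m + length (concat t'')} \<and>
      length xs = m + length (concat t'')}"
    using len by (auto simp: T_def set_inv_std intro!: imageI)
  then have "finite T"
    by (rule finite_subset) (intro finite_imageI finite_lists_length_eq, simp)
  \<comment> \<open>The set \<open>W\<close> is a union of classes of words with equal recording
    tableau: the tableau determines the length of the word and the recording tableaux of the factors
    starting at 0 and at \<open>m\<close>.\<close>
  have W_iff: "w \<in> W \<longleftrightarrow> P_symbol (inv_std w) \<in> T" for w
  proof
    assume "P_symbol (inv_std w) \<in> T"
    then obtain v where v: "v \<in> W" "P_symbol (inv_std v) = P_symbol (inv_std w)"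
      by (auto simp: T_def)
    have "length w = length v"
      using v(2) length_concat_P_symbol[of "inv_std v"] length_concat_P_symbol[of "inv_std w"]
      by simp
    then show "w \<in> W"
      using v P_symbol_inv_std_factor[OF v(2), of 0 "Suc m"]
        P_symbol_inv_std_factor[OF v(2), of m "length v - m"]
      by (simp add: W_def)
  qed (auto simp: T_def)
  \<comment> \<open>At each word \<open>w\<close> only the summand for the recording tableau of
    \<open>w\<close> can be nonzero.\<close>
  have "S t' \<sharp> S t'' = (\<Sum>t \<in> T. S t :: ('a, 'k) series)"
    using \<open>finite T\<close> by (simp add: fun_eq_iff sum_fun_apply S_apply coeff W_iff)
  also have "\<dots> \<in> FSym"
    unfolding FSym_def
  proof (intro span_sum span_base)
    fix t assume "t \<in> T"
    then obtain w where w: "w \<in> W" "t = P_symbol (inv_std w)" by (auto simp: T_def)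
    then have "standard_tableau t"
      by (auto intro!: standard_tableau_P_symbol simp: distinct_inv_std set_inv_std)
    moreover have "t \<noteq> []"
      using w by (auto simp: P_symbol_eq_Nil_iff W_def dest: arg_cong[of _ _ length])
    ultimately show "(S t :: ('a, 'k) series) \<in> {S t |t. standard_tableau t \<and> t \<noteq> []}"
      by blast
  qed
  finally show ?thesis .
qed

text \<open>The product of two generators lies in \<open>FSym\<close> by
  \<open>S_sharp_S_in_FSym\<close>; bilinearity extends this to the span, one argument at a
  time.\<close>

theorem theorem4p11:
  fixes a :: "nat \<Rightarrow> 'a::linorder"
  assumes "strict_mono a" and "range a = UNIV"
  shows "(\<forall>f \<in> FSym. \<forall>g \<in> FSym. f \<sharp> g \<in> (FSym :: ('a, 'k::field) series set)) \<and>
    (\<forall>t' t''. standard_tableau t' \<and> t' \<noteq> [] \<and> standard_tableau t'' \<and> t'' \<noteq> [] \<longrightarrow>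
       S t' \<sharp> S t'' \<in> (FSym :: ('a, 'k) series set))"
proof (intro conjI ballI allI impI)
  interpret vector_space "series_scale :: 'k \<Rightarrow> ('a, 'k) series \<Rightarrow> _"
    by (rule vector_space_series)
  have subspace: "subspace (FSym :: ('a, 'k) series set)"
    unfolding FSym_def by (rule subspace_span)
  fix f g :: "('a, 'k) series"
  assume f: "f \<in> FSym" and g: "g \<in> FSym"
  show "f \<sharp> g \<in> FSym"
    using f[unfolded FSym_def]
  proof (rule span_induct)
    show "subspace {f. f \<sharp> g \<in> FSym}"
      using subspace by (auto simp: subspace_def sharp_linear)
    fix f :: "('a, 'k) series"
    assume "f \<in> {S t |t. standard_tableau t \<and> t \<noteq> []}"
    then obtain t where t: "f = S t" "t \<noteq> []" by auto
    \<comment> \<open>With the left factor now a generator, the same span induction runs over the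
      right factor.\<close>
    show "f \<sharp> g \<in> FSym"
      using g[unfolded FSym_def]
    proof (rule span_induct)
      show "subspace {g. f \<sharp> g \<in> FSym}"
        using subspace by (auto simp: subspace_def sharp_linear)
    qed (use t S_sharp_S_in_FSym in auto)
  qed
qed (use S_sharp_S_in_FSym in auto)

end
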